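(* Suppose that for each $j\in\mathbb{N}_d$ and each $k\in\mathbb{N}_{q_j}$, $\bm{\psi}_{j,k}:\mathbb{R}^{s_{j,k}}\to\mathbb{R}_+$ is a convex function, that $\bm{\psi}_j:\mathbb{R}^{m_j}\to\mathbb{R}_+$ is the $\mathcal{S}_{m_j,q_j}$-block separable function $$\bm{\psi}_j(\mathbf{u}_j)=\sum_{k\in\mathbb{N}_{q_j}}\bm{\psi}_{j,k}(\mathbf{u}_{j,k}),\quad \mathbf{u}_j\in\mathbb{R}^{m_j},$$ and that $\bm{\psi}(\mathbf{u})=\sum_{j\in\mathbb{N}_d}\bm{\psi}_j(\mathbf{u}_j)$ for $\mathbf{u}\in\mathbb{R}^n$. Let $\lambda_j>0$ and $l_j\in\mathbb{Z}_{q_j+1}$ for $j\in\mathbb{N}_d$. Then the problem $$\min\Big\{\bm{\psi}(\mathbf{u})+\sum_{j\in\mathbb{N}_d}\lambda_j\|\mathbf{u}_j\|_1:\mathbf{u}\in\mathbb{R}^n\Big\}$$ has a solution $\mathbf{u}^*$ such that for each $j\in\mathbb{N}_d$, $\mathbf{u}^*_j$ has $\mathcal{S}_{m_j,q_j}$-block sparsity of some level $l'_j\le l_j$, if and only if for each $j\in\mathbb{N}_d$ there exist distinct $k_{j,i}\in\mathbb{N}_{q_j}$, $i\in\mathbb{N}_{l_j}$, such that $$\lambda_j\ge\min\big\{\|\mathbf{y}\|_\infty:\mathbf{y}\in\partial\bm{\psi}_{j,k}(\mathbf{0})\big\},\quad\text{for all } k\in\mathbb{N}_{q_j}\setminus\{k_{j,i}:i\in\mathbb{N}_{l_j}\}.$$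 In particular, if the functions $\bm{\psi}_{j,k}$, $j\in\mathbb{N}_d$, $k\in\mathbb{N}_{q_j}$, are differentiable, then the last condition reduces to $$\lambda_j\ge\|\nabla\bm{\psi}_{j,k}(\mathbf{0})\|_\infty,\quad\text{for all } k\in\mathbb{N}_{q_j}\setminus\{k_{j,i}:i\in\mathbb{N}_{l_j}\}.$$
   Context: Notation: $\mathbb{N}_m:=\{1,\dots,m\}$, $\mathbb{N}_0:=\emptyset$, $\mathbb{Z}_s:=\{0,1,\dots,s-1\}$, $\mathbb{R}_+:=[0,+\infty)$; $\partial$ is the convex subdifferential. Let $n,d\in\mathbb{N}$, $m_j\in\mathbb{N}$ for $j\in\mathbb{N}_d$, $p_0:=0$, $p_j:=\sum_{i\in\mathbb{N}_j}m_i$, and assume $p_d=n$. A vector $\mathbf{u}\in\mathbb{R}^n$ is decomposed into sub-vectors $\mathbf{u}_j:=[u_{p_{j-1}+i}:i\in\mathbb{N}_{m_j}]\in\mathbb{R}^{m_j}$, $j\in\mathbb{N}_d$. For each $j\in\mathbb{N}_d$, $\mathcal{S}_{m_j,q_j}=\{S_{m_j,1},\dots,S_{m_j,q_j}\}$ is a partition of $\mathbb{N}_{m_j}$ into $q_j$ nonempty pairwise disjoint sets, $s_{j,k}$ is the cardinality of $S_{m_j,k}$, and $\mathbf{u}_{j,k}\in\mathbb{R}^{s_{j,k}}$ denotes the sub-vector of $\mathbf{u}_j$ formed by the components with index in $S_{m_j,k}$ (in increasing order). A vector of $\mathbb{R}^{m_j}$ has $\mathcal{S}_{m_j,q_j}$-block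 sparsity of level $l\in\mathbb{Z}_{q_j+1}$ if exactly $l$ of its $q_j$ sub-vectors with respect to this partition are nonzero. *)

theory Defs
  imports Complex_Main "Jordan_Normal_Form.Matrix"
begin

text \<open>
  The space of real vectors of dimension \<open>s\<close> is \<open>carrier_vec s :: rvec set\<close>. Components of vectors
  are numbered from \<open>0\<close>, so index sets are subsets of \<open>{..<s}\<close>; sub-vectors and blocks are
  numbered from \<open>1\<close>. A function on this space is a function on \<open>rvec\<close> whose values outside
  \<open>carrier_vec s\<close> are irrelevant.
\<close>

type_synonym rvec = "real Matrix.vec"

definition l1_norm :: "rvec \<Rightarrow> real" where
  "l1_norm v = (\<Sum>i<dim_vec v. \<bar>v $ i\<bar>)"

definition l2_norm :: "rvec \<Rightarrow> real" where
  "l2_norm v = sqrt (\<Sum>i<dim_vec v. (v $ i)\<^sup>2)"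

text \<open>Inserting \<open>0\<close> only matters for the empty vector.\<close>

definition linf_norm :: "rvec \<Rightarrow> real" where
  "linf_norm v = Max (insert 0 ((\<lambda>i. \<bar>v $ i\<bar>) ` {..<dim_vec v}))"

definition convex_fun :: "nat \<Rightarrow> (rvec \<Rightarrow> real) \<Rightarrow> bool" where
  "convex_fun s f \<longleftrightarrow>
     (\<forall>x\<in>carrier_vec s. \<forall>y\<in>carrier_vec s. \<forall>t\<in>{0..1}.
        f (t \<cdot>\<^sub>v x + (1 - t) \<cdot>\<^sub>v y) \<le> t * f x + (1 - t) * f y)"

definition subdifferential :: "nat \<Rightarrow> (rvec \<Rightarrow> real) \<Rightarrow> rvec \<Rightarrow> rvec set" where
  "subdifferential s f x =
     {y \<in> carrier_vec s. \<forall>z\<in>carrier_vec s. f z \<ge> f x + y \<bullet> (z - x)}"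

text \<open>Frechet differentiability at \<open>x\<close>, with the derivative represented by the vector \<open>g\<close>.\<close>

definition has_gradient :: "nat \<Rightarrow> (rvec \<Rightarrow> real) \<Rightarrow> rvec \<Rightarrow> rvec \<Rightarrow> bool" where
  "has_gradient s f g x \<longleftrightarrow>
     g \<in> carrier_vec s \<and>
     (\<forall>\<epsilon>>0. \<exists>\<delta>>0. \<forall>h\<in>carrier_vec s. l2_norm h < \<delta> \<longrightarrow>
        \<bar>f (x + h) - f x - g \<bullet> h\<bar> \<le> \<epsilon> * l2_norm h)"

definition differentiable_fun :: "nat \<Rightarrow> (rvec \<Rightarrow> real) \<Rightarrow> bool" where
  "differentiable_fun s f \<longleftrightarrow> (\<forall>x\<in>carrier_vec s. \<exists>g. has_gradient s f g x)"

definition gradient :: "nat \<Rightarrow> (rvec \<Rightarrow> real) \<Rightarrow> rvec \<Rightarrow> rvec" where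
  "gradient s f x = (THE g. has_gradient s f g x)"

text \<open>The \<open>j\<close>-th sub-vector, for \<open>j \<ge> 1\<close>; its offset is \<open>m 1 + \<dots> + m (j - 1)\<close>.\<close>

definition subvec :: "(nat \<Rightarrow> nat) \<Rightarrow> nat \<Rightarrow> rvec \<Rightarrow> rvec" where
  "subvec m j u = vec (m j) (\<lambda>i. u $ ((\<Sum>i'\<in>{1..<j}. m i') + i))"

text \<open>The components with index in \<open>A\<close>, in increasing order of the index.\<close>

definition restrict_vec :: "nat set \<Rightarrow> rvec \<Rightarrow> rvec" where
  "restrict_vec A v = vec (card A) (\<lambda>i. v $ (sorted_list_of_set A ! i))"

definition indexed_partition :: "nat \<Rightarrow> nat \<Rightarrow> (nat \<Rightarrow> nat set) \<Rightarrow> bool" where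
  "indexed_partition s q S \<longleftrightarrow>
     (\<Union>k\<in>{1..q}. S k) = {..<s} \<and> (\<forall>k\<in>{1..q}. S k \<noteq> {}) \<and>
     (\<forall>k\<in>{1..q}. \<forall>k'\<in>{1..q}. k \<noteq> k' \<longrightarrow> S k \<inter> S k' = {})"

definition has_block_sparsity :: "nat \<Rightarrow> (nat \<Rightarrow> nat set) \<Rightarrow> rvec \<Rightarrow> nat \<Rightarrow> bool" where
  "has_block_sparsity q S v l \<longleftrightarrow>
     card {k \<in> {1..q}. restrict_vec (S k) v \<noteq> 0\<^sub>v (card (S k))} = l"

end

theory Submission
  imports Defs
begin

text \<open>
  Write \<open>\<parallel>z\<parallel>\<^sub>1\<close> for the \<open>\<ell>\<^sub>1\<close> norm. A partition of the coordinates splits it into the sum of the norms of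
  the blocks, so the objective is a sum of functions \<open>\<psi>\<^sub>j\<^sub>k(z) + \<lambda>\<^sub>j \<parallel>z\<parallel>\<^sub>1\<close> of pairwise disjoint groups of
  coordinates. Hence \<open>u\<close> minimizes the objective if and only if each of its blocks minimizes its
  own summand (\<open>is_arg_min_separable\<close>, with \<open>glue_blocks\<close> to assemble a vector from arbitrary blocks).
  Which sparsity levels occur is therefore decided by the number of blocks for which \<open>0\<close> is
  \<^emph>\<open>not\<close> a minimizer: every solution is nonzero there, and a solution can be chosen to vanish
  on all other blocks, since every block problem has some minimizer
  (\<open>exists_arg_min_l1_regularized\<close>). The distinct indices \<open>k\<^sub>j\<^sub>,\<^sub>i\<close> just say that at most \<open>l\<^sub>j\<close> blocks
  are exceptional (\<open>exists_exceptions_iff\<close>).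

  The analytic core is that \<open>0\<close> minimizes \<open>f + \<lambda> \<parallel>\<cdot>\<parallel>\<^sub>1\<close> if and only if \<open>f\<close> has a subgradient \<open>y\<close> at \<open>0\<close>
  with \<open>\<parallel>y\<parallel>\<^sub>\<infinity> \<le> \<lambda>\<close>. If \<open>y\<close> exists, then \<open>f(0) - f(z) \<le> - y \<bullet> z \<le> \<lambda> \<parallel>z\<parallel>\<^sub>1\<close>. For the converse, the terms
  \<open>\<lambda> \<bar>z\<^sub>i\<bar>\<close> are replaced one coordinate at a time by linear terms \<open>- y\<^sub>i z\<^sub>i\<close> with \<open>\<bar>y\<^sub>i\<bar> \<le> \<lambda>\<close>, keeping the
  inequality. Each replacement is the one-dimensional step of the Hahn--Banach argument
  (\<open>separating_slope\<close>). The same step, applied along an increasing chain of coordinate subspaces,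
  shows that a convex function has a subgradient at every point (\<open>subgradient_exists\<close>). This
  supplies the lower semicontinuity needed for the existence of minimizers.

  The equivalence also shows that the least norm of a subgradient is attained
  (\<open>least_subgradient_norm\<close>): the set of \<open>\<lambda>\<close> for which \<open>0\<close> is a minimizer is cut out by non-strict
  linear inequalities in \<open>\<lambda>\<close>, hence it is closed. In the differentiable case the gradient is the
  only subgradient (\<open>subdifferential_eq_gradient\<close>), so the minimum is its norm.
\<close>

section \<open>Slopes along one coordinate\<close>

lemma convex_funD:
  assumes "convex_fun s f" "x \<in> carrier_vec s" "y \<in> carrier_vec s" "0 \<le> t" "t \<le> 1"
  shows "f (t \<cdot>\<^sub>v x + (1 - t) \<cdot>\<^sub>v y) \<le> t * f x + (1 - t) * f y"
  using assms unfolding convex_fun_def by auto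

lemma convex_fun_add_separable:
  assumes f: "convex_fun s f" and A: "A \<subseteq> {..<s}"
    and c: "\<And>i a b t. i \<in> A \<Longrightarrow> 0 \<le> t \<Longrightarrow> t \<le> 1 \<Longrightarrow>
              c i (t * a + (1 - t) * b) \<le> t * c i a + (1 - t) * c i b"
  shows "convex_fun s (\<lambda>z. f z + (\<Sum>i\<in>A. c i (z $ i)) + e)"
  unfolding convex_fun_def
proof (intro ballI)
  fix x y :: rvec and t :: real
  assume x: "x \<in> carrier_vec s" and y: "y \<in> carrier_vec s" and "t \<in> {0..1}"
  then have t: "0 \<le> t" "t \<le> 1" by auto
  have "(\<Sum>i\<in>A. c i ((t \<cdot>\<^sub>v x + (1 - t) \<cdot>\<^sub>v y) $ i)) = (\<Sum>i\<in>A. c i (t * x $ i + (1 - t) * y $ i))"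
    using A x y by (intro sum.cong) auto
  also have "\<dots> \<le> (\<Sum>i\<in>A. t * c i (x $ i) + (1 - t) * c i (y $ i))"
    by (intro sum_mono c t)
  also have "\<dots> = t * (\<Sum>i\<in>A. c i (x $ i)) + (1 - t) * (\<Sum>i\<in>A. c i (y $ i))"
    by (simp add: sum.distrib sum_distrib_left)
  finally show "f (t \<cdot>\<^sub>v x + (1 - t) \<cdot>\<^sub>v y) + (\<Sum>i\<in>A. c i ((t \<cdot>\<^sub>v x + (1 - t) \<cdot>\<^sub>v y) $ i)) + e
      \<le> t * (f x + (\<Sum>i\<in>A. c i (x $ i)) + e) + (1 - t) * (f y + (\<Sum>i\<in>A. c i (y $ i)) + e)"
    using convex_funD[OF f x y t] by (simp add: algebra_simps)
qed

lemma convex_fun_translate: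
  assumes f: "convex_fun s f" and x: "x \<in> carrier_vec s"
  shows "convex_fun s (\<lambda>w. f (x + w))"
  unfolding convex_fun_def
proof (intro ballI)
  fix y z :: rvec and t :: real
  assume y: "y \<in> carrier_vec s" and z: "z \<in> carrier_vec s" and "t \<in> {0..1}"
  then have t: "0 \<le> t" "t \<le> 1" by auto
  have "x + (t \<cdot>\<^sub>v y + (1 - t) \<cdot>\<^sub>v z) = t \<cdot>\<^sub>v (x + y) + (1 - t) \<cdot>\<^sub>v (x + z)"
    using x y z by (intro eq_vecI) (auto simp: algebra_simps)
  then show "f (x + (t \<cdot>\<^sub>v y + (1 - t) \<cdot>\<^sub>v z)) \<le> t * f (x + y) + (1 - t) * f (x + z)"
    using convex_funD[OF f _ _ t, of "x + y" "x + z"] x y z by simp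
qed

text \<open>
The segment from \<open>w\<close> to \<open>z\<close> crosses the hyperplane where the coordinate \<open>i\<close> vanishes. There \<open>\<phi>\<close> is
nonnegative, and convexity bounds it by the corresponding average of \<open>\<phi> z\<close> and \<open>\<phi> w\<close>. Divided by
the two coordinates, the conclusion reads \<open>\<phi> w / w\<^sub>i \<le> \<phi> z / z\<^sub>i\<close>: slopes from the negative side are
below slopes from the positive side.
\<close>

lemma opposite_sides:
  assumes f: "convex_fun s \<phi>" and i: "i < s"
    and K: "K \<subseteq> carrier_vec s"
      "\<And>x y t. x \<in> K \<Longrightarrow> y \<in> K \<Longrightarrow> 0 \<le> t \<Longrightarrow> t \<le> 1 \<Longrightarrow> t \<cdot>\<^sub>v x + (1 - t) \<cdot>\<^sub>v y \<in> K"
    and nonneg: "\<And>z. z \<in> K \<Longrightarrow> z $ i = 0 \<Longrightarrow> 0 \<le> \<phi> z"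
    and z: "z \<in> K" "0 < z $ i" and w: "w \<in> K" "w $ i < 0"
  shows "w $ i * \<phi> z \<le> z $ i * \<phi> w"
proof -
  define D where "D = z $ i - w $ i"
  \<comment> \<open>the weight of \<open>z\<close> at the point where the segment meets the hyperplane\<close>
  define t where "t = - w $ i / D"
  have D: "D > 0" using z w by (simp add: D_def)
  have t: "0 \<le> t" "t \<le> 1" "1 - t = z $ i / D"
    using D z w by (auto simp: t_def field_simps) (auto simp: D_def)
  have cz: "z \<in> carrier_vec s" and cw: "w \<in> carrier_vec s" using z w K by auto
  have "(t \<cdot>\<^sub>v z + (1 - t) \<cdot>\<^sub>v w) $ i = t * z $ i + (1 - t) * w $ i"
    using cz cw i by simp
  also have "\<dots> = 0" unfolding t(3) by (simp add: t_def)
  finally have "0 \<le> \<phi> (t \<cdot>\<^sub>v z + (1 - t) \<cdot>\<^sub>v w)"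
    using nonneg K(2)[OF z(1) w(1) t(1,2)] by blast
  also have "\<dots> \<le> t * \<phi> z + (1 - t) * \<phi> w" by (rule convex_funD[OF f cz cw t(1,2)])
  also have "\<dots> = (z $ i * \<phi> w - w $ i * \<phi> z) / D"
    unfolding t(3) by (simp add: t_def diff_divide_distrib)
  finally show ?thesis using D by (simp add: zero_le_divide_iff)
qed

text \<open>
The one-dimensional extension step of Hahn--Banach: by \<open>opposite_sides\<close> the admissible slopes form
an interval that is bounded by the slopes of the two sides. The numbers \<open>lo\<close> and \<open>hi\<close> are a priori
bounds for the slope: with \<open>\<plusminus> r\<close> they yield the bound on the norm of a subgradient, and with
two values of \<open>\<phi>\<close> they only keep the supremum finite. The convex set \<open>K\<close> stands for the whole
space or for a coordinate subspace.
\<close>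

lemma separating_slope:
  assumes f: "convex_fun s \<phi>" and i: "i < s"
    and K: "K \<subseteq> carrier_vec s"
      "\<And>x y t. x \<in> K \<Longrightarrow> y \<in> K \<Longrightarrow> 0 \<le> t \<Longrightarrow> t \<le> 1 \<Longrightarrow> t \<cdot>\<^sub>v x + (1 - t) \<cdot>\<^sub>v y \<in> K"
    and nonneg: "\<And>z. z \<in> K \<Longrightarrow> z $ i = 0 \<Longrightarrow> 0 \<le> \<phi> z"
    and lo: "\<And>z. z \<in> K \<Longrightarrow> 0 < z $ i \<Longrightarrow> lo * z $ i \<le> \<phi> z"
    and hi: "\<And>z. z \<in> K \<Longrightarrow> z $ i < 0 \<Longrightarrow> hi * z $ i \<le> \<phi> z"
    and le: "lo \<le> hi"
  obtains c where "lo \<le> c" "c \<le> hi" "\<And>z. z \<in> K \<Longrightarrow> c * z $ i \<le> \<phi> z"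
proof
  have opposite: "w $ i * \<phi> z \<le> z $ i * \<phi> w"
    if "z \<in> K" "0 < z $ i" "w \<in> K" "w $ i < 0" for z w
    by (rule opposite_sides[OF f i K(1)]) (use K(2) nonneg that in auto)
  \<comment> \<open>including \<open>lo\<close> makes the supremum at least \<open>lo\<close> and the set nonempty\<close>
  define L where "L = insert lo {\<phi> w / w $ i | w. w \<in> K \<and> w $ i < 0}"
  have le_hi: "r \<le> hi" if "r \<in> L" for r
    using that le hi unfolding L_def by (auto simp: field_simps)
  then have bdd: "bdd_above L" by (rule bdd_aboveI)
  show "lo \<le> Sup L" by (rule cSup_upper[OF _ bdd]) (simp add: L_def)
  show "Sup L \<le> hi" using le_hi by (intro cSup_least) (auto simp: L_def)
  show "Sup L * z $ i \<le> \<phi> z" if z: "z \<in> K" for z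
  proof (cases "z $ i" "0 :: real" rule: linorder_cases)
    case less
    then have "\<phi> z / z $ i \<le> Sup L" using z by (intro cSup_upper[OF _ bdd]) (auto simp: L_def)
    then show ?thesis using less by (simp add: field_simps)
  next
    case equal
    then show ?thesis using nonneg[OF z] by simp
  next
    case greater
    have "Sup L \<le> \<phi> z / z $ i"
    proof (rule cSup_least)
      fix r assume "r \<in> L"
      then consider "r = lo" | w where "w \<in> K" "w $ i < 0" "r = \<phi> w / w $ i"
        unfolding L_def by auto
      then show "r \<le> \<phi> z / z $ i"
      proof cases
        case 1
        then show ?thesis using lo[OF z greater] greater by (simp add: field_simps)
      next
        case 2
        then have "w $ i * \<phi> z \<le> w $ i * (r * z $ i)"
          using opposite[OF z greater 2(1,2)] by (simp add: mult.commute)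
        then have "r * z $ i \<le> \<phi> z" using 2(2) by simp
        then show ?thesis using greater by (simp add: field_simps)
      qed
    qed (auto simp: L_def)
    then show ?thesis using greater by (simp add: field_simps)
  qed
qed

section \<open>Subgradients at the origin and the norm penalty\<close>

lemma linf_norm_le_iff:
  "linf_norm y \<le> r \<longleftrightarrow> 0 \<le> r \<and> (\<forall>i<dim_vec y. \<bar>y $ i\<bar> \<le> r)"
  unfolding linf_norm_def by (subst Max_le_iff) auto

lemma linf_norm_nonneg: "0 \<le> linf_norm y"
  using linf_norm_le_iff[of y "linf_norm y"] by simp

lemma l1_norm_nonneg: "0 \<le> l1_norm z"
  by (simp add: l1_norm_def sum_nonneg)

lemma l1_norm_pos:
  assumes "z \<in> carrier_vec s" "z \<noteq> 0\<^sub>v s" shows "0 < l1_norm z"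
proof -
  from assms obtain i where "i < s" "z $ i \<noteq> 0" by (metis carrier_vecD eq_vecI index_zero_vec)
  then show ?thesis using assms(1) unfolding l1_norm_def by (intro sum_pos2[of _ i]) auto
qed

lemma scalar_prod_le_linf_l1:
  assumes "y \<in> carrier_vec s" "z \<in> carrier_vec s"
  shows "\<bar>y \<bullet> z\<bar> \<le> linf_norm y * l1_norm z"
proof -
  have "\<bar>y \<bullet> z\<bar> \<le> (\<Sum>i<s. \<bar>y $ i\<bar> * \<bar>z $ i\<bar>)"
    using assms unfolding scalar_prod_def
    by (simp add: atLeast0LessThan order.trans[OF sum_abs] abs_mult)
  also have "\<dots> \<le> (\<Sum>i<s. linf_norm y * \<bar>z $ i\<bar>)"
    using linf_norm_le_iff[of y "linf_norm y"] assms by (intro sum_mono mult_right_mono) auto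
  finally show ?thesis using assms by (simp add: l1_norm_def sum_distrib_left)
qed

lemma subgradient_zero_iff:
  assumes "y \<in> carrier_vec s"
  shows "y \<in> subdifferential s f (0\<^sub>v s) \<longleftrightarrow>
    (\<forall>z\<in>carrier_vec s. f (0\<^sub>v s) + (\<Sum>i<s. y $ i * z $ i) \<le> f z)"
  using assms by (auto simp: subdifferential_def scalar_prod_def atLeast0LessThan minus_vec_def)

text \<open>
Induction on the number \<open>k\<close> of coordinates whose penalty \<open>r \<bar>z\<^sub>i\<bar>\<close> has already been replaced by a
linear term \<open>- y\<^sub>i z\<^sub>i\<close>. After the last step no penalty is left, and the inequality says that \<open>y\<close> is
a subgradient.
\<close>

lemma subgradient_if_zero_minimizes:
  assumes f: "convex_fun s f" and "0 \<le> r"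
    and min: "\<And>z. z \<in> carrier_vec s \<Longrightarrow> f (0\<^sub>v s) \<le> f z + r * l1_norm z"
  obtains y where "y \<in> subdifferential s f (0\<^sub>v s)" "linf_norm y \<le> r"
proof -
  have "\<exists>y. (\<forall>i<k. \<bar>y i\<bar> \<le> r) \<and> (\<forall>z\<in>carrier_vec s.
      f (0\<^sub>v s) \<le> f z + (\<Sum>i<s. if i < k then - (y i * z $ i) else r * \<bar>z $ i\<bar>))"
    if "k \<le> s" for k
    using that
  proof (induction k)
    case 0
    then show ?case using min by (auto simp: l1_norm_def sum_distrib_left)
  next
    case (Suc k)
    then have k: "k < s" by simp
    define h where "h y i a = (if i < k then - (y i * a) else r * \<bar>a\<bar>)" for y and i :: nat and a
    from Suc obtain y where y: "\<And>i. i < k \<Longrightarrow> \<bar>y i\<bar> \<le> r"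
        "\<And>z. z \<in> carrier_vec s \<Longrightarrow> f (0\<^sub>v s) \<le> f z + (\<Sum>i<s. h y i (z $ i))"
      unfolding h_def by auto
    have split: "(\<Sum>i<s. g i) = g k + (\<Sum>i\<in>{..<s} - {k}. g i)" for g :: "nat \<Rightarrow> real"
      using k by (subst sum.remove[of _ k]) auto
    \<comment> \<open>all terms but the penalty of the coordinate \<open>k\<close>, which is the next one to be replaced\<close>
    define \<phi> where "\<phi> z = f z + (\<Sum>i\<in>{..<s} - {k}. h y i (z $ i)) + - f (0\<^sub>v s)" for z
    have convex: "convex_fun s \<phi>"
      unfolding \<phi>_def
    proof (rule convex_fun_add_separable[OF f])
      fix i a b and t :: real assume t: "0 \<le> t" "t \<le> 1"
      have "\<bar>t * a + (1 - t) * b\<bar> \<le> t * \<bar>a\<bar> + (1 - t) * \<bar>b\<bar>"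
        using t by (intro order.trans[OF abs_triangle_ineq]) (simp add: abs_mult)
      from mult_left_mono[OF this \<open>0 \<le> r\<close>]
      show "h y i (t * a + (1 - t) * b) \<le> t * h y i a + (1 - t) * h y i b"
        by (simp add: h_def algebra_simps)
    qed auto
    have \<phi>: "0 \<le> \<phi> z + r * \<bar>z $ k\<bar>" if "z \<in> carrier_vec s" for z
      using y(2)[OF that] by (simp add: \<phi>_def split h_def)
    obtain c where c: "- r \<le> c" "c \<le> r" "\<And>z. z \<in> carrier_vec s \<Longrightarrow> c * z $ k \<le> \<phi> z"
    proof (rule separating_slope[OF convex k, where K = "carrier_vec s" and lo = "- r" and hi = r])
      fix z :: rvec assume z: "z \<in> carrier_vec s"
      show "0 \<le> \<phi> z" if "z $ k = 0" using \<phi>[OF z] that by simp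
      show "- r * z $ k \<le> \<phi> z" if "0 < z $ k" using \<phi>[OF z] that by simp
      show "r * z $ k \<le> \<phi> z" if "z $ k < 0" using \<phi>[OF z] that by simp
    qed (use \<open>0 \<le> r\<close> in auto)
    have "(if i < Suc k then - ((y(k := c)) i * a) else r * \<bar>a\<bar>)
        = (if i = k then - (c * a) else h y i a)" for i a
      by (auto simp: h_def)
    moreover have "f (0\<^sub>v s) \<le> f z + (\<Sum>i<s. if i = k then - (c * z $ i) else h y i (z $ i))"
      if "z \<in> carrier_vec s" for z
      using c(3)[OF that] by (simp add: split \<phi>_def)
    ultimately show ?case
      using y(1) c(1,2) by (intro exI[of _ "y(k := c)"]) (auto simp: less_Suc_eq abs_le_iff)
  qed
  from this[of s] obtain y where y: "\<And>i. i < s \<Longrightarrow> \<bar>y i\<bar> \<le> r"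
      "\<And>z. z \<in> carrier_vec s \<Longrightarrow> f (0\<^sub>v s) + (\<Sum>i<s. y i * z $ i) \<le> f z"
    by (auto simp: sum_negf le_diff_eq)
  show thesis
  proof (rule that[of "vec s y"])
    show "vec s y \<in> subdifferential s f (0\<^sub>v s)"
      using y(2) by (subst subgradient_zero_iff) auto
    show "linf_norm (vec s y) \<le> r" using y(1) \<open>0 \<le> r\<close> by (simp add: linf_norm_le_iff)
  qed
qed

text \<open>
Induction on \<open>k\<close>: an affine minorant that is exact at \<open>0\<close> is extended from the subspace of the vectors
supported on the first \<open>k\<close> coordinates to the next one.
\<close>

lemma subgradient_zero_exists:
  assumes f: "convex_fun s f"
  shows "subdifferential s f (0\<^sub>v s) \<noteq> {}"
proof -
  have "\<exists>y. \<forall>z\<in>carrier_vec s. (\<forall>i. k \<le> i \<longrightarrow> i < s \<longrightarrow> z $ i = 0) \<longrightarrow>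
      f (0\<^sub>v s) \<le> f z + (\<Sum>i<k. - (y i * z $ i))" if "k \<le> s" for k
    using that
  proof (induction k)
    case 0
    have "z = 0\<^sub>v s" if "z \<in> carrier_vec s" "\<forall>i<s. z $ i = 0" for z :: rvec
      using that by (intro eq_vecI) auto
    then show ?case by auto
  next
    case (Suc k)
    then have k: "k < s" by simp
    define K where "K = {z \<in> carrier_vec s. \<forall>i. Suc k \<le> i \<longrightarrow> i < s \<longrightarrow> z $ i = (0 :: real)}"
    from Suc obtain y where y: "\<And>z. z \<in> carrier_vec s \<Longrightarrow> (\<And>i. k \<le> i \<Longrightarrow> i < s \<Longrightarrow> z $ i = 0) \<Longrightarrow>
        f (0\<^sub>v s) \<le> f z + (\<Sum>i<k. - (y i * z $ i))" by auto
    define \<phi> where "\<phi> z = f z + (\<Sum>i<k. - (y i * z $ i)) + - f (0\<^sub>v s)" for z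
    have convex: "convex_fun s \<phi>"
      unfolding \<phi>_def using k
      by (intro convex_fun_add_separable[OF f, where c = "\<lambda>i a. - (y i * a)"])
        (auto simp: algebra_simps)
    have K: "K \<subseteq> carrier_vec s"
      "\<And>x y t. x \<in> K \<Longrightarrow> y \<in> K \<Longrightarrow> 0 \<le> t \<Longrightarrow> t \<le> 1 \<Longrightarrow> t \<cdot>\<^sub>v x + (1 - t) \<cdot>\<^sub>v y \<in> K"
      by (auto simp: K_def)
    have nonneg: "0 \<le> \<phi> z" if "z \<in> K" "z $ k = 0" for z
    proof -
      have "z $ i = 0" if "k \<le> i" "i < s" for i
        using \<open>z \<in> K\<close> \<open>z $ k = 0\<close> that by (cases "i = k") (auto simp: K_def)
      then show ?thesis using y[of z] \<open>z \<in> K\<close> by (simp add: \<phi>_def K_def)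
    qed
    have opposite: "w $ k * \<phi> z \<le> z $ k * \<phi> w"
      if "z \<in> K" "0 < z $ k" "w \<in> K" "w $ k < 0" for z w
      by (rule opposite_sides[OF convex k K(1)]) (use K(2) nonneg that in auto)
    \<comment> \<open>the values of \<open>\<phi>\<close> at \<open>\<plusminus> e\<close> bound the slopes of the two sides\<close>
    define e where "e = (unit_vec s k :: rvec)"
    have e: "e \<in> K" "- e \<in> K" "e $ k = 1" "(- e) $ k = - 1" using k by (auto simp: e_def K_def)
    obtain c where c: "\<And>z. z \<in> K \<Longrightarrow> c * z $ k \<le> \<phi> z"
    proof (rule separating_slope[OF convex k K(1), where lo = "- \<phi> (- e)" and hi = "\<phi> e"])
      show "- \<phi> (- e) * z $ k \<le> \<phi> z" if "z \<in> K" "0 < z $ k" for z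
        using opposite[OF that e(2)] e by (simp add: mult.commute)
      show "\<phi> e * z $ k \<le> \<phi> z" if "z \<in> K" "z $ k < 0" for z
        using opposite[OF e(1) _ that] e by (simp add: mult.commute)
      show "- \<phi> (- e) \<le> \<phi> e" using opposite[OF e(1) _ e(2)] e by simp
    qed (use K(2) nonneg in auto)
    have "f (0\<^sub>v s) \<le> f z + (\<Sum>i<Suc k. - ((y(k := c)) i * z $ i))" if "z \<in> K" for z
    proof -
      have "(\<Sum>i<Suc k. - ((y(k := c)) i * z $ i)) = (\<Sum>i<k. - (y i * z $ i)) - c * z $ k"
        by simp
      then show ?thesis using c[OF that] by (simp add: \<phi>_def)
    qed
    then show ?case by (intro exI[of _ "y(k := c)"]) (auto simp: K_def)
  qed
  from this[of s] obtain y where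
    y: "\<And>z. z \<in> carrier_vec s \<Longrightarrow> f (0\<^sub>v s) + (\<Sum>i<s. y i * z $ i) \<le> f z"
    by (auto simp: sum_negf le_diff_eq)
  have "vec s y \<in> subdifferential s f (0\<^sub>v s)"
    using y by (subst subgradient_zero_iff) auto
  then show ?thesis by blast
qed

lemma subgradient_exists:
  assumes f: "convex_fun s f" and x: "x \<in> carrier_vec s"
  shows "subdifferential s f x \<noteq> {}"
proof -
  obtain y where y: "y \<in> subdifferential s (\<lambda>w. f (x + w)) (0\<^sub>v s)"
    using subgradient_zero_exists[OF convex_fun_translate[OF f x]] by blast
  have "f x + y \<bullet> (z - x) \<le> f z" if z: "z \<in> carrier_vec s" for z
  proof -
    have "f (x + 0\<^sub>v s) + y \<bullet> ((z - x) - 0\<^sub>v s) \<le> f (x + (z - x))"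
      using y x z unfolding subdifferential_def by auto
    moreover have "x + (z - x) = z" "(z - x) - 0\<^sub>v s = z - x" "x + 0\<^sub>v s = x"
      using x z by (auto intro!: eq_vecI)
    ultimately show ?thesis by simp
  qed
  then have "y \<in> subdifferential s f x" using y by (auto simp: subdifferential_def)
  then show ?thesis by blast
qed

lemma zero_minimizes_if_subgradient:
  assumes y: "y \<in> subdifferential s f (0\<^sub>v s)" and z: "z \<in> carrier_vec s"
  shows "f (0\<^sub>v s) \<le> f z + linf_norm y * l1_norm z"
proof -
  have "f (0\<^sub>v s) + y \<bullet> z \<le> f z" and "y \<in> carrier_vec s"
    using y z by (auto simp: subdifferential_def)
  then show ?thesis using scalar_prod_le_linf_l1[of y s z] z by (simp add: abs_le_iff)
qed

text \<open>
Attainment without compactness: with \<open>\<rho>\<close> the infimum of the norms, each single inequality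
\<open>f 0 \<le> f z + r \<parallel>z\<parallel>\<^sub>1\<close>, valid for the norm \<open>r\<close> of any subgradient, persists for \<open>r = \<rho>\<close>. Then
\<open>subgradient_if_zero_minimizes\<close> returns a subgradient of norm at most \<open>\<rho>\<close>. This also makes the
value of \<open>LEAST\<close> meaningful, which it is not for a set of reals without a least element.
\<close>

lemma least_subgradient_norm:
  assumes f: "convex_fun s f"
  obtains y where "y \<in> subdifferential s f (0\<^sub>v s)"
    "(LEAST r. r \<in> linf_norm ` subdifferential s f (0\<^sub>v s)) = linf_norm y"
    "\<And>y'. y' \<in> subdifferential s f (0\<^sub>v s) \<Longrightarrow> linf_norm y \<le> linf_norm y'"
proof -
  let ?D = "subdifferential s f (0\<^sub>v s)"
  define \<rho> where "\<rho> = Inf (linf_norm ` ?D)"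
  have ne: "?D \<noteq> {}" by (rule subgradient_zero_exists[OF f])
  have bdd: "bdd_below (linf_norm ` ?D)" by (rule bdd_belowI[of _ 0]) (auto simp: linf_norm_nonneg)
  have nonneg: "0 \<le> \<rho>"
    unfolding \<rho>_def using ne by (intro cInf_greatest) (auto simp: linf_norm_nonneg)
  have "f (0\<^sub>v s) \<le> f z + \<rho> * l1_norm z" if z: "z \<in> carrier_vec s" for z
  proof (cases "z = 0\<^sub>v s")
    case True
    then show ?thesis using nonneg l1_norm_nonneg[of z] by simp
  next
    case False
    note pos = l1_norm_pos[OF z False]
    have "(f (0\<^sub>v s) - f z) / l1_norm z \<le> \<rho>"
      unfolding \<rho>_def
    proof (rule cInf_greatest)
      fix r assume "r \<in> linf_norm ` ?D"
      then show "(f (0\<^sub>v s) - f z) / l1_norm z \<le> r"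
        using zero_minimizes_if_subgradient[OF _ z] pos by (fastforce simp: field_simps)
    qed (use ne in auto)
    then show ?thesis using pos by (simp add: field_simps)
  qed
  then obtain y where y: "y \<in> ?D" "linf_norm y \<le> \<rho>"
    using subgradient_if_zero_minimizes[OF f nonneg] by blast
  have least: "linf_norm y \<le> linf_norm y'" if "y' \<in> ?D" for y'
    using y(2) cInf_lower[OF _ bdd, of "linf_norm y'"] that by (auto simp: \<rho>_def)
  moreover have "(LEAST r. r \<in> linf_norm ` ?D) = linf_norm y"
    using y(1) least by (intro Least_equality) auto
  ultimately show thesis using that y(1) by blast
qed

lemma zero_is_arg_min_iff:
  assumes f: "convex_fun s f" and r: "0 \<le> r"
  shows "is_arg_min (\<lambda>z. f z + r * l1_norm z) (\<lambda>z. z \<in> carrier_vec s) (0\<^sub>v s) \<longleftrightarrow>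
    (LEAST r. r \<in> linf_norm ` subdifferential s f (0\<^sub>v s)) \<le> r"
proof -
  obtain y where y: "y \<in> subdifferential s f (0\<^sub>v s)"
    "(LEAST r. r \<in> linf_norm ` subdifferential s f (0\<^sub>v s)) = linf_norm y"
    "\<And>y'. y' \<in> subdifferential s f (0\<^sub>v s) \<Longrightarrow> linf_norm y \<le> linf_norm y'"
    using least_subgradient_norm[OF f] by metis
  have "is_arg_min (\<lambda>z. f z + r * l1_norm z) (\<lambda>z. z \<in> carrier_vec s) (0\<^sub>v s) \<longleftrightarrow>
      (\<forall>z\<in>carrier_vec s. f (0\<^sub>v s) \<le> f z + r * l1_norm z)"
    by (auto simp: is_arg_min_def l1_norm_def not_less)
  also have "\<dots> \<longleftrightarrow> linf_norm y \<le> r"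
  proof
    assume "\<forall>z\<in>carrier_vec s. f (0\<^sub>v s) \<le> f z + r * l1_norm z"
    then obtain y' where "y' \<in> subdifferential s f (0\<^sub>v s)" "linf_norm y' \<le> r"
      using subgradient_if_zero_minimizes[OF f r] by blast
    then show "linf_norm y \<le> r" using y(3) by fastforce
  next
    assume "linf_norm y \<le> r"
    then have "linf_norm y * l1_norm z \<le> r * l1_norm z" for z
      by (intro mult_right_mono l1_norm_nonneg)
    then show "\<forall>z\<in>carrier_vec s. f (0\<^sub>v s) \<le> f z + r * l1_norm z"
      using zero_minimizes_if_subgradient[OF y(1)] by (smt (verit))
  qed
  finally show ?thesis by (simp add: y(2))
qed

section \<open>Existence of minimizers\<close>

lemma convergent_subsequence_coordinatewise:
  fixes X :: "nat \<Rightarrow> nat \<Rightarrow> real"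
  assumes "\<And>i n. i < s \<Longrightarrow> \<bar>X n i\<bar> \<le> R"
  obtains r where "strict_mono r" "\<And>i. i < s \<Longrightarrow> convergent (\<lambda>n. X (r n) i)"
proof -
  have "\<exists>r. strict_mono r \<and> (\<forall>i<k. convergent (\<lambda>n. X (r n) i))" if "k \<le> s" for k
    using that
  proof (induction k)
    case 0
    then show ?case by (auto intro!: exI[of _ id] simp: strict_mono_def)
  next
    case (Suc k)
    then obtain r where r: "strict_mono r" "\<And>i. i < k \<Longrightarrow> convergent (\<lambda>n. X (r n) i)" by auto
    obtain r' where r': "strict_mono r'" "monoseq (\<lambda>n. X (r (r' n)) k)"
      using seq_monosub[of "\<lambda>n. X (r n) k"] by auto
    have "Bseq (\<lambda>n. X (r (r' n)) k)"
      using assms[of k] Suc.prems by (auto intro!: BseqI'[of _ R])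
    then have "convergent (\<lambda>n. X (r (r' n)) k)" using r'(2) by (rule Bseq_monoseq_convergent)
    moreover have "convergent (\<lambda>n. X (r (r' n)) i)" if "i < k" for i
      using convergent_subseq_convergent[OF r(2)[OF that] r'(1)] by (simp add: o_def)
    moreover have "strict_mono (\<lambda>n. r (r' n))" using r(1) r'(1) by (auto simp: strict_mono_def)
    ultimately show ?case by (intro exI[of _ "\<lambda>n. r (r' n)"]) (auto simp: less_Suc_eq)
  qed
  then show thesis using that by blast
qed

text \<open>
The direct method. As \<open>f\<close> is nonnegative, the penalty bounds a minimizing sequence, so a subsequence
converges in each coordinate to some \<open>x\<close>. A subgradient of \<open>f\<close> at \<open>x\<close> gives a continuous minorant of
the objective that agrees with it at \<open>x\<close>. This replaces the continuity of \<open>f\<close> in the passage to the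
limit.
\<close>

lemma exists_arg_min_l1_regularized:
  assumes f: "convex_fun s f"
    and nonneg: "\<And>z. z \<in> carrier_vec s \<Longrightarrow> 0 \<le> f z" and r: "0 < r"
  obtains x where "is_arg_min (\<lambda>z. f z + r * l1_norm z) (\<lambda>z. z \<in> carrier_vec s) x"
proof -
  define F where "F z = f z + r * l1_norm z" for z
  define I where "I = Inf (F ` carrier_vec s)"
  have bdd: "bdd_below (F ` carrier_vec s)"
    using nonneg r l1_norm_nonneg by (intro bdd_belowI[of _ 0]) (auto simp: F_def)
  have I_le: "I \<le> F z" if "z \<in> carrier_vec s" for z
    unfolding I_def using that by (intro cInf_lower bdd) auto
  have "\<exists>z\<in>carrier_vec s. F z < I + 1 / Suc n" for n
  proof -
    have "F ` carrier_vec s \<noteq> {}" using zero_carrier_vec by blast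
    then show ?thesis
      using cInf_lessD[of "F ` carrier_vec s" "I + 1 / Suc n"] by (auto simp: I_def)
  qed
  then obtain Z where Z: "\<And>n. Z n \<in> carrier_vec s" "\<And>n. F (Z n) < I + 1 / Suc n" by metis
  have "\<bar>Z n $ i\<bar> \<le> (I + 1) / r" if "i < s" for i n
  proof -
    have "\<bar>Z n $ i\<bar> \<le> l1_norm (Z n)"
      unfolding l1_norm_def using that Z(1)[of n] by (intro member_le_sum) auto
    moreover have "r * l1_norm (Z n) \<le> I + 1"
    proof -
      have "1 / real (Suc n) \<le> 1" by simp
      then show ?thesis using nonneg[OF Z(1)[of n]] Z(2)[of n] unfolding F_def by linarith
    qed
    ultimately show ?thesis using r by (simp add: field_simps) (smt (verit) mult_left_mono)
  qed
  then obtain \<sigma> where \<sigma>: "strict_mono \<sigma>" "\<And>i. i < s \<Longrightarrow> convergent (\<lambda>n. Z (\<sigma> n) $ i)"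
    using convergent_subsequence_coordinatewise[of s "\<lambda>n i. Z n $ i"] by blast
  define x where "x = vec s (\<lambda>i. lim (\<lambda>n. Z (\<sigma> n) $ i))"
  have x: "x \<in> carrier_vec s" by (simp add: x_def)
  have lim: "(\<lambda>n. Z (\<sigma> n) $ i) \<longlonglongrightarrow> x $ i" if "i < s" for i
    using \<sigma>(2)[OF that] that by (simp add: x_def convergent_LIMSEQ_iff)
  obtain y where y: "y \<in> subdifferential s f x" using subgradient_exists[OF f x] by blast
  \<comment> \<open>the minorant along the subsequence\<close>
  define low where "low n = f x + (\<Sum>i<s. y $ i * (Z (\<sigma> n) $ i - x $ i)) + r * (\<Sum>i<s. \<bar>Z (\<sigma> n) $ i\<bar>)" for n
  have "low n \<le> F (Z (\<sigma> n))" for n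
  proof -
    have "f x + y \<bullet> (Z (\<sigma> n) - x) \<le> f (Z (\<sigma> n))"
      using y Z(1) by (auto simp: subdifferential_def)
    moreover have "y \<bullet> (Z (\<sigma> n) - x) = (\<Sum>i<s. y $ i * (Z (\<sigma> n) $ i - x $ i))"
      using x Z(1)[of "\<sigma> n"] by (simp add: scalar_prod_def atLeast0LessThan)
    ultimately show ?thesis
      using Z(1)[of "\<sigma> n"] by (simp add: low_def F_def l1_norm_def)
  qed
  then have le: "low n \<le> I + 1 / Suc (\<sigma> n)" for n
    using Z(2)[of "\<sigma> n"] by (rule order.trans[OF _ less_imp_le])
  have "low \<longlonglongrightarrow> f x + (\<Sum>i<s. y $ i * (x $ i - x $ i)) + r * (\<Sum>i<s. \<bar>x $ i\<bar>)"
    unfolding low_def by (intro tendsto_intros lim) auto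
  then have "low \<longlonglongrightarrow> F x" using x by (simp add: F_def l1_norm_def)
  moreover have "(\<lambda>n. I + 1 / Suc (\<sigma> n)) \<longlonglongrightarrow> I + 0"
    using LIMSEQ_subseq_LIMSEQ[OF LIMSEQ_inverse_real_of_nat \<sigma>(1)]
    by (intro tendsto_add tendsto_const) (simp add: o_def inverse_eq_divide)
  ultimately have "F x \<le> I" using le LIMSEQ_le[of low "F x"] by auto
  then have "is_arg_min F (\<lambda>z. z \<in> carrier_vec s) x"
    using x I_le by (fastforce simp: is_arg_min_def not_less)
  then show thesis using that by (simp add: F_def[abs_def])
qed

section \<open>Subgradients of differentiable functions\<close>

lemma l2_norm_squared: "(l2_norm v)\<^sup>2 = v \<bullet> v"
  by (simp add: l2_norm_def scalar_prod_def atLeast0LessThan sum_nonneg power2_eq_square)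

lemma l2_norm_smult: "l2_norm (t \<cdot>\<^sub>v v) = \<bar>t\<bar> * l2_norm v"
  by (simp add: l2_norm_def power_mult_distrib real_sqrt_mult flip: sum_distrib_left)

lemma l2_norm_eq_0:
  assumes "v \<in> carrier_vec s" "l2_norm v = 0" shows "v = 0\<^sub>v s"
  using assms by (intro eq_vecI) (auto simp: l2_norm_def sum_nonneg_eq_0_iff)

text \<open>
For the difference \<open>v = y - g\<close> and small \<open>t > 0\<close>, the increment of \<open>f\<close> along \<open>t v\<close> is at least
\<open>t (y \<bullet> v)\<close> by the subgradient inequality, and it differs from \<open>t (g \<bullet> v)\<close> by at most
\<open>\<epsilon> t \<parallel>v\<parallel>\<close>. Thus \<open>t \<parallel>v\<parallel>\<^sup>2 \<le> \<epsilon> t \<parallel>v\<parallel>\<close> for every \<open>\<epsilon> > 0\<close>, which forces \<open>v = 0\<close>.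
\<close>

lemma gradient_unique_subgradient:
  assumes y: "y \<in> subdifferential s f x" and g: "has_gradient s f g x"
    and x: "x \<in> carrier_vec s"
  shows "y = g"
proof -
  have cy: "y \<in> carrier_vec s" and cg: "g \<in> carrier_vec s"
    using y g by (auto simp: subdifferential_def has_gradient_def)
  define v where "v = y - g"
  have v: "v \<in> carrier_vec s" using cy cg by (simp add: v_def)
  have nonneg: "0 \<le> l2_norm v" by (simp add: l2_norm_def sum_nonneg)
  have "l2_norm v \<le> \<epsilon>" if eps: "0 < \<epsilon>" for \<epsilon>
  proof (cases "l2_norm v = 0")
    case False
    then have pos: "0 < l2_norm v" using nonneg by simp
    obtain \<delta> where \<delta>: "\<delta> > 0" "\<forall>h\<in>carrier_vec s. l2_norm h < \<delta> \<longrightarrow>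
        \<bar>f (x + h) - f x - g \<bullet> h\<bar> \<le> \<epsilon> * l2_norm h"
      using g eps unfolding has_gradient_def by blast
    define t where "t = \<delta> / (2 * l2_norm v)"
    have t: "0 < t" "l2_norm (t \<cdot>\<^sub>v v) < \<delta>"
      using pos \<delta>(1) by (auto simp: t_def l2_norm_smult)
    have "x + t \<cdot>\<^sub>v v - x = t \<cdot>\<^sub>v v" using x v by (intro eq_vecI) auto
    moreover have "f x + y \<bullet> (x + t \<cdot>\<^sub>v v - x) \<le> f (x + t \<cdot>\<^sub>v v)"
      using y x v unfolding subdifferential_def by auto
    ultimately have "y \<bullet> (t \<cdot>\<^sub>v v) - g \<bullet> (t \<cdot>\<^sub>v v) \<le> \<epsilon> * l2_norm (t \<cdot>\<^sub>v v)"
      using \<delta>(2)[rule_format, OF _ t(2)] v by auto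
    also have "y \<bullet> (t \<cdot>\<^sub>v v) - g \<bullet> (t \<cdot>\<^sub>v v) = t * (v \<bullet> v)"
      using cy cg v by (simp add: v_def minus_scalar_prod_distrib algebra_simps)
    finally have "t * (l2_norm v * l2_norm v) \<le> t * (\<epsilon> * l2_norm v)"
      using t(1) by (simp add: l2_norm_smult mult.left_commute flip: l2_norm_squared power2_eq_square)
    then show ?thesis using t(1) pos by simp
  qed (use that in simp)
  then have "l2_norm v = 0" using nonneg field_le_epsilon[of "l2_norm v" 0] by force
  then have "v = 0\<^sub>v s" by (rule l2_norm_eq_0[OF v])
  then show "y = g" using cy cg unfolding v_def
    by (metis carrier_vecD eq_vecI index_minus_vec(1) index_zero_vec(1) right_minus_eq)
qed

text \<open>
Since a subgradient exists and equals every gradient, the gradient is also unique, so that the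
definite description in \<open>gradient\<close> denotes it.
\<close>

lemma subdifferential_eq_gradient:
  assumes convex: "convex_fun s f" and f: "differentiable_fun s f"
    and x: "x \<in> carrier_vec s"
  shows "subdifferential s f x = {gradient s f x}"
proof -
  note sub = subgradient_exists[OF convex x]
  obtain g where g: "has_gradient s f g x" using f x by (auto simp: differentiable_fun_def)
  have "subdifferential s f x = {g}"
    using sub gradient_unique_subgradient[OF _ g x] by blast
  moreover have "gradient s f x = g"
    unfolding gradient_def
    using g sub gradient_unique_subgradient[OF _ _ x] by (metis ex_in_conv the_equality)
  ultimately show ?thesis by simp
qed

section \<open>Separable minimization and blocks\<close>

text \<open>
For the forward direction one coordinate \<open>B a u\<close> is exchanged while all others are kept. The
hypothesis \<open>glue\<close> says that the values \<open>B a u\<close> can be prescribed independently of each other.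
\<close>

lemma is_arg_min_separable:
  fixes G :: "'a \<Rightarrow> 'b \<Rightarrow> real"
  assumes I: "finite I"
    and F: "\<And>u. u \<in> X \<Longrightarrow> F u = (\<Sum>a\<in>I. G a (B a u))"
    and B: "\<And>u a. u \<in> X \<Longrightarrow> a \<in> I \<Longrightarrow> B a u \<in> C a"
    and glue: "\<And>v. (\<And>a. a \<in> I \<Longrightarrow> v a \<in> C a) \<Longrightarrow> \<exists>u\<in>X. \<forall>a\<in>I. B a u = v a"
  shows "is_arg_min F (\<lambda>u. u \<in> X) u \<longleftrightarrow>
    u \<in> X \<and> (\<forall>a\<in>I. is_arg_min (G a) (\<lambda>z. z \<in> C a) (B a u))"
proof (intro iffI conjI ballI)
  assume min: "is_arg_min F (\<lambda>u. u \<in> X) u"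
  then show u: "u \<in> X" by (simp add: is_arg_min_def)
  fix a assume a: "a \<in> I"
  have "G a (B a u) \<le> G a z" if z: "z \<in> C a" for z
  proof -
    obtain u' where u': "u' \<in> X" "\<And>b. b \<in> I \<Longrightarrow> B b u' = ((\<lambda>b. B b u)(a := z)) b"
      using glue[of "(\<lambda>b. B b u)(a := z)"] B[OF u] z by (metis fun_upd_apply)
    have "(\<Sum>b\<in>I. G b (B b u)) \<le> (\<Sum>b\<in>I. G b (B b u'))"
      using min u'(1) u F unfolding is_arg_min_def by (metis not_less)
    also have "(\<Sum>b\<in>I. G b (B b u')) = G a z + (\<Sum>b\<in>I - {a}. G b (B b u))"
      using u'(2) a by (simp add: sum.remove[OF I a])
    finally show ?thesis by (simp add: sum.remove[OF I a])
  qed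
  then show "is_arg_min (G a) (\<lambda>z. z \<in> C a) (B a u)"
    using B[OF u a] by (auto simp: is_arg_min_def not_less)
next
  assume *: "u \<in> X \<and> (\<forall>a\<in>I. is_arg_min (G a) (\<lambda>z. z \<in> C a) (B a u))"
  have "F u \<le> F u'" if "u' \<in> X" for u'
  proof -
    have "G a (B a u) \<le> G a (B a u')" if "a \<in> I" for a
      using * B[OF \<open>u' \<in> X\<close> that] that by (auto simp: is_arg_min_def not_less)
    then show ?thesis using * that by (simp add: F sum_mono)
  qed
  then show "is_arg_min F (\<lambda>u. u \<in> X) u" using * by (auto simp: is_arg_min_def not_less)
qed

lemma exists_vec_with_coordinates:
  assumes bound: "\<And>a. a \<in> A \<Longrightarrow> e a < n" and inj: "inj_on e A"
  obtains u :: rvec where "u \<in> carrier_vec n" "\<And>a. a \<in> A \<Longrightarrow> u $ e a = c a"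
proof
  let ?u = "vec n (\<lambda>p. c (the_inv_into A e p)) :: rvec"
  show "?u \<in> carrier_vec n" by simp
  show "?u $ e a = c a" if "a \<in> A" for a
    using bound[OF that] the_inv_into_f_f[OF inj that] by simp
qed

lemma l1_norm_blocks:
  assumes S: "indexed_partition s q S" and w: "w \<in> carrier_vec s"
  shows "l1_norm w = (\<Sum>k\<in>{1..q}. l1_norm (restrict_vec (S k) w))"
proof -
  have fin: "finite (S k)" if "k \<in> {1..q}" for k
    using S that by (intro finite_subset[of "S k" "{..<s}"]) (auto simp: indexed_partition_def)
  have "l1_norm w = (\<Sum>i\<in>(\<Union>k\<in>{1..q}. S k). \<bar>w $ i\<bar>)"
    using S w by (simp add: l1_norm_def indexed_partition_def)
  also have "\<dots> = (\<Sum>k\<in>{1..q}. \<Sum>i\<in>S k. \<bar>w $ i\<bar>)"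
    using S fin by (intro sum.UNION_disjoint) (auto simp: indexed_partition_def)
  also have "\<dots> = (\<Sum>k\<in>{1..q}. l1_norm (restrict_vec (S k) w))"
  proof (rule sum.cong)
    fix k assume k: "k \<in> {1..q}"
    have "bij_betw (\<lambda>r. sorted_list_of_set (S k) ! r) {..<card (S k)} (S k)"
      using fin[OF k] by (intro bij_betw_nth) auto
    then show "(\<Sum>i\<in>S k. \<bar>w $ i\<bar>) = l1_norm (restrict_vec (S k) w)"
      by (simp add: l1_norm_def restrict_vec_def sum.reindex_bij_betw flip: sum.reindex_bij_betw)
  qed simp
  finally show ?thesis .
qed

lemma sub_vector_range_end:
  fixes m :: "nat \<Rightarrow> nat"
  assumes "j \<in> {1..d}"
  shows "(\<Sum>i\<in>{1..<j}. m i) + m j \<le> (\<Sum>i\<in>{1..d}. m i)"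
proof -
  have "(\<Sum>i\<in>{1..<j}. m i) + m j = (\<Sum>i\<in>{1..j}. m i)"
    using assms by (simp add: sum.last_plus)
  also have "\<dots> \<le> (\<Sum>i\<in>{1..d}. m i)" using assms by (intro sum_mono2) auto
  finally show ?thesis .
qed

text \<open>
The entry \<open>r\<close> of the block \<open>(j, k)\<close> sits at a position of \<open>u\<close> that determines \<open>(j, k, r)\<close>: the ranges of
the sub-vectors do not overlap, the index sets \<open>S j k\<close> are disjoint for fixed \<open>j\<close>, and the sorted list
of an index set has no repetitions. So arbitrary blocks are the blocks of some vector.
\<close>

lemma glue_blocks:
  assumes m: "(\<Sum>j\<in>{1..d}. m j) = n"
    and S: "\<forall>j\<in>{1..d}. indexed_partition (m j) (q j) (S j)"
    and v: "\<And>j k. j \<in> {1..d} \<Longrightarrow> k \<in> {1..q j} \<Longrightarrow> v j k \<in> carrier_vec (card (S j k))"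
  obtains u where "u \<in> carrier_vec n"
    "\<forall>j\<in>{1..d}. \<forall>k\<in>{1..q j}. restrict_vec (S j k) (subvec m j u) = v j k"
proof -
  define off where "off j = (\<Sum>i\<in>{1..<j}. m i)" for j
  define pos where "pos j k r = sorted_list_of_set (S j k) ! r" for j k r
  define A where "A = (SIGMA j:{1..d}. SIGMA k:{1..q j}. {..<card (S j k)})"
  define e where "e = (\<lambda>(j, k, r). off j + pos j k r)"
  have S_sub: "S j k \<subseteq> {..<m j}" if "j \<in> {1..d}" "k \<in> {1..q j}" for j k
    using S that unfolding indexed_partition_def by blast
  have fin: "finite (S j k)" if "j \<in> {1..d}" "k \<in> {1..q j}" for j k
    using S_sub[OF that] finite_subset by blast
  have pos: "pos j k r \<in> S j k" "pos j k r < m j" if "(j, k, r) \<in> A" for j k r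
  proof -
    have "j \<in> {1..d}" "k \<in> {1..q j}" "r < card (S j k)" using that by (auto simp: A_def)
    then show "pos j k r \<in> S j k"
      using fin nth_mem[of r "sorted_list_of_set (S j k)"] by (simp add: pos_def)
    then show "pos j k r < m j"
      using S_sub \<open>j \<in> {1..d}\<close> \<open>k \<in> {1..q j}\<close> by blast
  qed
  have off_less: "off j + x < off j'" if "j < j'" "j \<in> {1..d}" "x < m j" for j j' x
    using sub_vector_range_end[of j "j' - 1" m] that by (cases j') (auto simp: off_def atLeastLessThanSuc_atLeastAtMost)
  have "inj_on e A"
  proof (rule inj_onI)
    fix a b assume a: "a \<in> A" and b: "b \<in> A" and eq: "e a = e b"
    obtain j k r where a': "a = (j, k, r)" by (cases a)
    obtain j' k' r' where b': "b = (j', k', r')" by (cases b)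
    have ar: "j \<in> {1..d}" "k \<in> {1..q j}" "r < card (S j k)" using a by (auto simp: a' A_def)
    have br: "j' \<in> {1..d}" "k' \<in> {1..q j'}" "r' < card (S j' k')" using b by (auto simp: b' A_def)
    note pa = pos[OF a[unfolded a']] and pb = pos[OF b[unfolded b']]
    have sum: "off j + pos j k r = off j' + pos j' k' r'" using eq by (simp add: a' b' e_def)
    have j: "j = j'"
    proof (rule ccontr)
      assume "j \<noteq> j'"
      then consider "j < j'" | "j' < j" by linarith
      then show False
        using off_less[of j j' "pos j k r"] off_less[of j' j "pos j' k' r'"] ar br pa pb sum
        by cases auto
    qed
    then have p: "pos j k r = pos j k' r'" using sum by simp
    have k: "k = k'"
      using S ar br pa(1) pb(1) p j unfolding indexed_partition_def by (metis disjoint_iff)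
    then have "r = r'"
      using p j fin[OF ar(1,2)] ar(3) br(3)
      by (simp add: pos_def nth_eq_iff_index_eq)
    then show "a = b" using j k by (simp add: a' b')
  qed
  moreover have "e a < n" if "a \<in> A" for a
  proof -
    obtain j k r where a': "a = (j, k, r)" by (cases a)
    have "j \<in> {1..d}" using that by (auto simp: a' A_def)
    then show ?thesis
      using sub_vector_range_end[of j d m] pos(2)[OF that[unfolded a']] m
      by (simp add: a' e_def off_def)
  qed
  ultimately obtain u :: rvec where u: "u \<in> carrier_vec n"
      "\<And>a. a \<in> A \<Longrightarrow> u $ e a = (\<lambda>(j, k, r). v j k $ r) a"
    using exists_vec_with_coordinates[of A e n] by blast
  have "restrict_vec (S j k) (subvec m j u) = v j k" if jk: "j \<in> {1..d}" "k \<in> {1..q j}" for j k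
  proof (rule eq_vecI)
    show "dim_vec (restrict_vec (S j k) (subvec m j u)) = dim_vec (v j k)"
      using v[OF jk] by (simp add: restrict_vec_def)
    fix r assume "r < dim_vec (v j k)"
    then have r: "r < card (S j k)" using v[OF jk] by simp
    then have mem: "(j, k, r) \<in> A" using jk by (auto simp: A_def)
    show "restrict_vec (S j k) (subvec m j u) $ r = v j k $ r"
      using u(2)[OF mem] pos(2)[OF mem] r
      by (simp add: restrict_vec_def subvec_def e_def pos_def off_def)
  qed
  then show thesis using that u(1) by blast
qed

text \<open>
The image of \<open>\<kappa>\<close> is an arbitrary \<open>l\<close>-element subset of \<open>{1..q}\<close> containing all \<open>k\<close> that violate \<open>P\<close>.
If there are fewer violations, it is filled up with other indices, for which \<open>l \<le> q\<close> leaves room.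
\<close>

lemma exists_exceptions_iff:
  assumes "l \<le> (q :: nat)"
  shows "(\<exists>\<kappa> :: nat \<Rightarrow> nat. inj_on \<kappa> {1..l} \<and> \<kappa> ` {1..l} \<subseteq> {1..q} \<and> (\<forall>k\<in>{1..q} - \<kappa> ` {1..l}. P k))
    \<longleftrightarrow> card {k \<in> {1..q}. \<not> P k} \<le> l"
proof
  assume "\<exists>\<kappa> :: nat \<Rightarrow> nat. inj_on \<kappa> {1..l} \<and> \<kappa> ` {1..l} \<subseteq> {1..q} \<and> (\<forall>k\<in>{1..q} - \<kappa> ` {1..l}. P k)"
  then obtain \<kappa> :: "nat \<Rightarrow> nat" where "\<forall>k\<in>{1..q} - \<kappa> ` {1..l}. P k" by blast
  then have "card {k \<in> {1..q}. \<not> P k} \<le> card (\<kappa> ` {1..l})" by (intro card_mono) auto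
  also have "\<dots> \<le> l" using card_image_le[of "{1..l}" \<kappa>] by simp
  finally show "card {k \<in> {1..q}. \<not> P k} \<le> l" .
next
  assume "card {k \<in> {1..q}. \<not> P k} \<le> l"
  then obtain T where T: "{k \<in> {1..q}. \<not> P k} \<subseteq> T" "T \<subseteq> {1..q}" "card T = l"
  proof -
    have "{k \<in> {1..q}. \<not> P k} \<subseteq> {1..q}" "l \<le> card {1..q}" using assms by auto
    then show ?thesis
      using exists_subset_between[OF \<open>card {k \<in> {1..q}. \<not> P k} \<le> l\<close>] that by blast
  qed
  then have "finite T" using finite_subset by blast
  then obtain \<kappa> where "bij_betw \<kappa> {1..l} T"
    using T(3) finite_same_card_bij[of "{1..l}" T] by auto
  then show "\<exists>\<kappa> :: nat \<Rightarrow> nat. inj_on \<kappa> {1..l} \<and> \<kappa> ` {1..l} \<subseteq> {1..q} \<and> (\<forall>k\<in>{1..q} - \<kappa> ` {1..l}. P k)"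
    using T(1,2) by (intro exI[of _ \<kappa>]) (auto simp: bij_betw_def)
qed

section \<open>Block sparse solutions\<close>

theorem theorem3:
  fixes n d :: nat
    and m q l :: "nat \<Rightarrow> nat"
    and S :: "nat \<Rightarrow> nat \<Rightarrow> nat set"
    and \<psi>b :: "nat \<Rightarrow> nat \<Rightarrow> rvec \<Rightarrow> real"
    and \<psi>s :: "nat \<Rightarrow> rvec \<Rightarrow> real"
    and \<psi> :: "rvec \<Rightarrow> real"
    and lam :: "nat \<Rightarrow> real"
  assumes "n \<ge> 1" and "d \<ge> 1"
    and "\<forall>j\<in>{1..d}. m j \<ge> 1"
    and "(\<Sum>j\<in>{1..d}. m j) = n"
    and "\<forall>j\<in>{1..d}. indexed_partition (m j) (q j) (S j)"
    and "\<forall>j\<in>{1..d}. \<forall>k\<in>{1..q j}.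
           convex_fun (card (S j k)) (\<psi>b j k) \<and>
           (\<forall>x\<in>carrier_vec (card (S j k)). \<psi>b j k x \<ge> 0)"
    and "\<forall>j\<in>{1..d}. \<forall>v\<in>carrier_vec (m j).
           \<psi>s j v = (\<Sum>k\<in>{1..q j}. \<psi>b j k (restrict_vec (S j k) v))"
    and "\<forall>u\<in>carrier_vec n. \<psi> u = (\<Sum>j\<in>{1..d}. \<psi>s j (subvec m j u))"
    and "\<forall>j\<in>{1..d}. lam j > 0"
    and "\<forall>j\<in>{1..d}. l j \<le> q j"
  shows
    "((\<exists>u. is_arg_min (\<lambda>u. \<psi> u + (\<Sum>j\<in>{1..d}. lam j * l1_norm (subvec m j u)))
              (\<lambda>u. u \<in> carrier_vec n) u \<and>
           (\<forall>j\<in>{1..d}. \<exists>l'\<le>l j. has_block_sparsity (q j) (S j) (subvec m j u) l'))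
      \<longleftrightarrow>
      (\<forall>j\<in>{1..d}. \<exists>\<kappa>. inj_on \<kappa> {1..l j} \<and> \<kappa> ` {1..l j} \<subseteq> {1..q j} \<and>
         (\<forall>k\<in>{1..q j} - \<kappa> ` {1..l j}.
            lam j \<ge> (LEAST r. r \<in> linf_norm `
              subdifferential (card (S j k)) (\<psi>b j k) (0\<^sub>v (card (S j k)))))))
     \<and>
     ((\<forall>j\<in>{1..d}. \<forall>k\<in>{1..q j}. differentiable_fun (card (S j k)) (\<psi>b j k)) \<longrightarrow>
      (\<forall>j\<in>{1..d}. \<forall>\<kappa>. inj_on \<kappa> {1..l j} \<and> \<kappa> ` {1..l j} \<subseteq> {1..q j} \<longrightarrow>
         ((\<forall>k\<in>{1..q j} - \<kappa> ` {1..l j}.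
             lam j \<ge> (LEAST r. r \<in> linf_norm `
               subdifferential (card (S j k)) (\<psi>b j k) (0\<^sub>v (card (S j k)))))
          \<longleftrightarrow>
          (\<forall>k\<in>{1..q j} - \<kappa> ` {1..l j}.
             lam j \<ge> linf_norm (gradient (card (S j k)) (\<psi>b j k) (0\<^sub>v (card (S j k)))))))
      \<and>
      ((\<exists>u. is_arg_min (\<lambda>u. \<psi> u + (\<Sum>j\<in>{1..d}. lam j * l1_norm (subvec m j u)))
               (\<lambda>u. u \<in> carrier_vec n) u \<and>
            (\<forall>j\<in>{1..d}. \<exists>l'\<le>l j. has_block_sparsity (q j) (S j) (subvec m j u) l'))
       \<longleftrightarrow>
       (\<forall>j\<in>{1..d}. \<exists>\<kappa>. inj_on \<kappa> {1..l j} \<and> \<kappa> ` {1..l j} \<subseteq> {1..q j} \<and>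
          (\<forall>k\<in>{1..q j} - \<kappa> ` {1..l j}.
             lam j \<ge> linf_norm (gradient (card (S j k)) (\<psi>b j k) (0\<^sub>v (card (S j k))))))))"
proof -
  define I where "I = (SIGMA j:{1..d}. {1..q j})"
  define obj where "obj u = \<psi> u + (\<Sum>j\<in>{1..d}. lam j * l1_norm (subvec m j u))" for u
  define B where "B = (\<lambda>(j, k) u. restrict_vec (S j k) (subvec m j u))"
  define C where "C = (\<lambda>(j, k). carrier_vec (card (S j k)) :: rvec set)"
  define G where "G = (\<lambda>(j, k) z. \<psi>b j k z + lam j * l1_norm z)"
  define L where "L j k = (LEAST r. r \<in> linf_norm `
      subdifferential (card (S j k)) (\<psi>b j k) (0\<^sub>v (card (S j k))))" for j k
  define sparse where "sparse u \<longleftrightarrow>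
      (\<forall>j\<in>{1..d}. \<exists>l'\<le>l j. has_block_sparsity (q j) (S j) (subvec m j u) l')" for u
  note convex = assms(6)[rule_format, THEN conjunct1]
  note nonneg = assms(6)[rule_format, THEN conjunct2, rule_format]
  note lam_pos = assms(9)[rule_format]

  have obj_blocks: "obj u = (\<Sum>a\<in>I. G a (B a u))" if "u \<in> carrier_vec n" for u
  proof -
    have subvec: "subvec m j u \<in> carrier_vec (m j)" for j by (simp add: subvec_def)
    have "obj u = (\<Sum>j\<in>{1..d}. \<psi>s j (subvec m j u) + lam j * l1_norm (subvec m j u))"
      using assms(8) that by (simp add: obj_def sum.distrib)
    also have "\<dots> = (\<Sum>j\<in>{1..d}. \<Sum>k\<in>{1..q j}. G (j, k) (B (j, k) u))"
      using assms(7) subvec l1_norm_blocks[OF assms(5)[rule_format] subvec]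
      by (intro sum.cong) (simp_all add: G_def B_def sum.distrib sum_distrib_left)
    also have "\<dots> = (\<Sum>a\<in>I. G a (B a u))"
      unfolding I_def by (subst sum.Sigma) (auto simp: case_prod_beta)
    finally show ?thesis .
  qed

  have glue: "\<exists>u\<in>carrier_vec n. \<forall>a\<in>I. B a u = v a" if v: "\<And>a. a \<in> I \<Longrightarrow> v a \<in> C a" for v
  proof -
    have "v (j, k) \<in> carrier_vec (card (S j k))" if "j \<in> {1..d}" "k \<in> {1..q j}" for j k
      using v[of "(j, k)"] that by (simp add: I_def C_def)
    then obtain u where "u \<in> carrier_vec n" "\<forall>j\<in>{1..d}. \<forall>k\<in>{1..q j}.
        restrict_vec (S j k) (subvec m j u) = v (j, k)"
      by (rule glue_blocks[OF assms(4,5), of "\<lambda>j k. v (j, k)"])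
    then show ?thesis by (intro bexI[of _ u]) (auto simp: I_def B_def)
  qed

  have block_min: "is_arg_min obj (\<lambda>u. u \<in> carrier_vec n) u \<longleftrightarrow>
      u \<in> carrier_vec n \<and> (\<forall>a\<in>I. is_arg_min (G a) (\<lambda>z. z \<in> C a) (B a u))" for u
  proof (rule is_arg_min_separable)
    show "finite I" by (simp add: I_def)
    show "B a u \<in> C a" for a u by (cases a) (simp add: B_def C_def restrict_vec_def)
  qed (use obj_blocks glue in auto)

  have zero_min: "is_arg_min (G (j, k)) (\<lambda>z. z \<in> C (j, k)) (0\<^sub>v (card (S j k))) \<longleftrightarrow> L j k \<le> lam j"
    if "j \<in> {1..d}" "k \<in> {1..q j}" for j k
    using zero_is_arg_min_iff[OF convex[OF that], of "lam j"] lam_pos[OF that(1)]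
    by (simp add: G_def C_def L_def)

  have sparse_iff: "sparse u \<longleftrightarrow>
      (\<forall>j\<in>{1..d}. card {k \<in> {1..q j}. B (j, k) u \<noteq> 0\<^sub>v (card (S j k))} \<le> l j)" for u
    by (simp add: sparse_def has_block_sparsity_def B_def)

  \<comment> \<open>the blocks with \<open>L j k > lam j\<close> are exactly those that are nonzero in every solution\<close>
  have main: "(\<exists>u. is_arg_min obj (\<lambda>u. u \<in> carrier_vec n) u \<and> sparse u) \<longleftrightarrow>
      (\<forall>j\<in>{1..d}. card {k \<in> {1..q j}. \<not> L j k \<le> lam j} \<le> l j)"
  proof (intro iffI ballI)
    fix j assume j: "j \<in> {1..d}"
    assume "\<exists>u. is_arg_min obj (\<lambda>u. u \<in> carrier_vec n) u \<and> sparse u"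
    then obtain u where u: "\<forall>a\<in>I. is_arg_min (G a) (\<lambda>z. z \<in> C a) (B a u)" "sparse u"
      using block_min by blast
    have "L j k \<le> lam j" if "k \<in> {1..q j}" "B (j, k) u = 0\<^sub>v (card (S j k))" for k
      using u(1) zero_min[OF j that(1)] that j by (force simp: I_def)
    then have "card {k \<in> {1..q j}. \<not> L j k \<le> lam j}
        \<le> card {k \<in> {1..q j}. B (j, k) u \<noteq> 0\<^sub>v (card (S j k))}"
      by (intro card_mono) auto
    also have "\<dots> \<le> l j" using u(2) j by (simp add: sparse_iff)
    finally show "card {k \<in> {1..q j}. \<not> L j k \<le> lam j} \<le> l j" .
  next
    assume few: "\<forall>j\<in>{1..d}. card {k \<in> {1..q j}. \<not> L j k \<le> lam j} \<le> l j"
    \<comment> \<open>choose the zero block wherever it is optimal, and any minimizer elsewhere\<close>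
    have "\<exists>z. is_arg_min (G (j, k)) (\<lambda>z. z \<in> C (j, k)) z \<and>
        (L j k \<le> lam j \<longrightarrow> z = 0\<^sub>v (card (S j k)))"
      if jk: "j \<in> {1..d}" "k \<in> {1..q j}" for j k
    proof (cases "L j k \<le> lam j")
      case True
      then show ?thesis using zero_min[OF jk] by blast
    next
      case False
      then show ?thesis
        using exists_arg_min_l1_regularized[OF convex[OF jk] nonneg[OF jk] lam_pos[OF jk(1)]]
        by (auto simp: G_def C_def)
    qed
    then obtain v where v: "\<And>j k. j \<in> {1..d} \<Longrightarrow> k \<in> {1..q j} \<Longrightarrow>
        is_arg_min (G (j, k)) (\<lambda>z. z \<in> C (j, k)) (v j k) \<and>
        (L j k \<le> lam j \<longrightarrow> v j k = 0\<^sub>v (card (S j k)))"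
      by metis
    obtain u where u: "u \<in> carrier_vec n" "\<forall>a\<in>I. B a u = (\<lambda>(j, k). v j k) a"
      using glue[of "\<lambda>(j, k). v j k"] v by (auto simp: I_def is_arg_min_def)
    have Bu: "B (j, k) u = v j k" if "j \<in> {1..d}" "k \<in> {1..q j}" for j k
      using u(2) that by (auto simp: I_def)
    have "is_arg_min obj (\<lambda>u. u \<in> carrier_vec n) u"
      using u(1) v Bu by (auto simp: block_min I_def)
    moreover have "card {k \<in> {1..q j}. B (j, k) u \<noteq> 0\<^sub>v (card (S j k))} \<le> l j"
      if j: "j \<in> {1..d}" for j
    proof -
      have "card {k \<in> {1..q j}. B (j, k) u \<noteq> 0\<^sub>v (card (S j k))}
          \<le> card {k \<in> {1..q j}. \<not> L j k \<le> lam j}"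
        using v[OF j] Bu[OF j] by (intro card_mono) auto
      then show ?thesis using few j by fastforce
    qed
    ultimately show "\<exists>u. is_arg_min obj (\<lambda>u. u \<in> carrier_vec n) u \<and> sparse u"
      by (auto simp: sparse_iff)
  qed

  have part1: "(\<exists>u. is_arg_min obj (\<lambda>u. u \<in> carrier_vec n) u \<and> sparse u) \<longleftrightarrow>
      (\<forall>j\<in>{1..d}. \<exists>\<kappa>. inj_on \<kappa> {1..l j} \<and> \<kappa> ` {1..l j} \<subseteq> {1..q j} \<and>
        (\<forall>k\<in>{1..q j} - \<kappa> ` {1..l j}. L j k \<le> lam j))"
    unfolding main using assms(10) by (intro ball_cong refl exists_exceptions_iff[symmetric]) auto

  have gradient: "L j k = linf_norm (gradient (card (S j k)) (\<psi>b j k) (0\<^sub>v (card (S j k))))"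
    if "\<forall>j\<in>{1..d}. \<forall>k\<in>{1..q j}. differentiable_fun (card (S j k)) (\<psi>b j k)"
      "j \<in> {1..d}" "k \<in> {1..q j}" for j k
    using subdifferential_eq_gradient[OF convex[OF that(2,3)]] that
    by (auto simp: L_def intro: Least_equality)

  have part2: "(\<forall>k\<in>{1..q j} - T. L j k \<le> lam j) \<longleftrightarrow>
      (\<forall>k\<in>{1..q j} - T. linf_norm (gradient (card (S j k)) (\<psi>b j k) (0\<^sub>v (card (S j k)))) \<le> lam j)"
    if "\<forall>j\<in>{1..d}. \<forall>k\<in>{1..q j}. differentiable_fun (card (S j k)) (\<psi>b j k)"
      "j \<in> {1..d}" for j T
    using gradient[OF that] by (intro ball_cong) auto
  show ?thesis
    unfolding obj_def[symmetric] sparse_def[symmetric] L_def[symmetric] part1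
  proof (intro conjI impI refl)
    assume diff: "\<forall>j\<in>{1..d}. \<forall>k\<in>{1..q j}. differentiable_fun (card (S j k)) (\<psi>b j k)"
    note cong = part2[OF diff]
    show "\<forall>j\<in>{1..d}. \<forall>\<kappa>. inj_on \<kappa> {1..l j} \<and> \<kappa> ` {1..l j} \<subseteq> {1..q j} \<longrightarrow>
        ((\<forall>k\<in>{1..q j} - \<kappa> ` {1..l j}. L j k \<le> lam j) \<longleftrightarrow>
         (\<forall>k\<in>{1..q j} - \<kappa> ` {1..l j}.
            linf_norm (gradient (card (S j k)) (\<psi>b j k) (0\<^sub>v (card (S j k)))) \<le> lam j))"
      by (intro ballI allI impI cong)
    show "(\<forall>j\<in>{1..d}. \<exists>\<kappa>. inj_on \<kappa> {1..l j} \<and> \<kappa> ` {1..l j} \<subseteq> {1..q j} \<and>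
          (\<forall>k\<in>{1..q j} - \<kappa> ` {1..l j}. L j k \<le> lam j)) \<longleftrightarrow>
        (\<forall>j\<in>{1..d}. \<exists>\<kappa>. inj_on \<kappa> {1..l j} \<and> \<kappa> ` {1..l j} \<subseteq> {1..q j} \<and>
          (\<forall>k\<in>{1..q j} - \<kappa> ` {1..l j}.
            linf_norm (gradient (card (S j k)) (\<psi>b j k) (0\<^sub>v (card (S j k)))) \<le> lam j))"
      by (intro ball_cong refl ex_cong1 conj_cong cong)
  qed
qed

end
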